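(* Let $\Gamma$ be a Lie pseudogroup of transformations of a manifold $Y$ with associated sheaf $\Theta$ of infinitesimal transformations, let $X$ be a manifold with coordinates $x=(x^1,\dots,x^n)$, and let $z=f(y,x)$, with $f_x=f(\cdot,x)\in\Gamma$ and inverse $y=g(z,x)$, be a section of $X\times\Gamma$ with generalized speed $$v(z,x)=\frac{\partial f}{\partial x}(g(z,x),x).$$ Let $\delta$ denote a variation of $f$ within sections of $X\times\Gamma$, and let $\xi=\xi(y,x)\in\Theta$ be the vertical vector field determined by $$\delta f(y,x)=\frac{\partial f}{\partial y}(y,x)\,\xi(y,x).$$ Then the variation of $v$ is $$\delta v=\frac{\partial f}{\partial y}\,\frac{\partial \xi}{\partial x},$$ that is, in components, $$\delta v^k_i(z,x)=\frac{\partial f^k}{\partial y^l}(g(z,x),x)\;\frac{\partial \xi^l}{\partial x^i}(g(z,x),x).$$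
   Context: All objects are smooth and all statements are local. $Y$ is a manifold of dimension $m$ with local coordinates $y=(y^1,\dots,y^m)$, and $Z$ is a copy of $Y$ with coordinates $z=(z^1,\dots,z^m)$. A Lie pseudogroup $\Gamma\subseteq\mathrm{aut}(Y)$ is a pseudogroup of (local, invertible) transformations $z=f(y)$ of $Y$ which are the solutions of a (generally nonlinear) system of partial differential equations of some order $q$ (the finite Lie equations): compositions (when defined) and inverses of solutions are solutions and the identity is a solution. Linearizing this system at the $q$-jet of the identity (setting $z=y+t\xi(y)+\cdots$ and letting $t\to0$) gives a linear system of partial differential equations for vector fields on $Y$, whose sheaf of germs of solutions is $\Theta$; it satisfies $[\Theta,\Theta]\subset\Theta$. The same notation is used on $Z$. A vertical vector field $\xi(y,x)\in\Theta$ is a family of vector fields on $Y$ depending on the parameter $x$ and belonging to $\Theta$ for each fixed $x$. The pseudogroup acts on $Y$, not on $X$. The generalized speed has components $v^k_i(z,x)=\frac{\partial f^k}{\partial x^i}(g(z,x),x)$. The variation $\delta$ is the derivative $\partial/\partial\epsilon$ for a smooth one-parameter family $f(y,x;\epsilon)$, with inverse $g(z,x;\epsilon)$, of sections of $X\times\Gamma$. In $\delta f$ the derivative is taken with $(y,x)$ fixed; in $\delta v$ it is taken with $(z,x)$ fixed, $(z,x,\epsilon)$ being considered as independent variables. In $\partial\xi/\partial x$ the derivative is taken with $y$ fixed. Equivalently, with $\eta(z,x)$ defined by $\eta(f(y,x),x)=\delta f(y,x)$, one has $\xi(g(z,x),x)=\frac{\partial g}{\partial z}(z,x)\,\eta(z,x)$.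 *)

theory Defs
  imports "HOL-Analysis.Analysis" "HOL-Library.Multiset"
begin

text \<open>All statements being local, a manifold is represented by an open set of coordinates
  in \<open>real ^ 'm\<close> (not necessarily connected, so that several charts can be treated at once).\<close>

text \<open>The derivatives are taken in the ambient space, so \<^term>\<open>S\<close> is meant to be open.\<close>

primrec Ck_on :: "nat \<Rightarrow> 'a set \<Rightarrow> ('a::real_normed_vector \<Rightarrow> 'b::real_normed_vector) \<Rightarrow> bool" where
  "Ck_on 0 S f \<longleftrightarrow> continuous_on S f"
| "Ck_on (Suc k) S f \<longleftrightarrow>
     (\<forall>x\<in>S. f differentiable (at x)) \<and> (\<forall>v. Ck_on k S (\<lambda>x. frechet_derivative f (at x) v))"

definition smooth_on :: "'a set \<Rightarrow> ('a::real_normed_vector \<Rightarrow> 'b::real_normed_vector) \<Rightarrow> bool" where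
  "smooth_on S f \<longleftrightarrow> (\<forall>k. Ck_on k S f)"


subsection \<open>Local transformations and their jets\<close>

text \<open>A local transformation is a pair of a domain and a map, of which only the values on the
  domain matter.\<close>

type_synonym 'm local_map = "(real ^ 'm) set \<times> (real ^ 'm \<Rightarrow> real ^ 'm)"

definition aut :: "(real ^ 'm) set \<Rightarrow> 'm local_map set" where
  "aut Y = {(S, f). open S \<and> S \<subseteq> Y \<and> f ` S \<subseteq> Y \<and> smooth_on S f \<and> inj_on f S \<and>
                    open (f ` S) \<and> smooth_on (f ` S) (inv_into S f)}"

definition partial :: "'m \<Rightarrow> (real ^ 'm \<Rightarrow> 'b::real_normed_vector) \<Rightarrow> real ^ 'm \<Rightarrow> 'b" where
  "partial i f = (\<lambda>y. frechet_derivative f (at y) (axis i 1))"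

text \<open>A multi-index is a multiset \<open>\<mu>\<close> of coordinate directions, of order \<^term>\<open>size \<mu>\<close>. The order in
  which the partial derivatives are taken is irrelevant for smooth functions.\<close>

definition multi_partial ::
  "'m multiset \<Rightarrow> (real ^ 'm \<Rightarrow> 'b::real_normed_vector) \<Rightarrow> real ^ 'm \<Rightarrow> 'b" where
  "multi_partial \<mu> f = foldr partial (SOME is. mset is = \<mu>) f"

text \<open>The jet space of order \<open>q\<close> has coordinates \<open>(y, z\<^sub>\<mu>)\<close> with \<open>\<mu>\<close> a multi-index of order at most
  \<open>q\<close>, the index \<open>{#}\<close> giving the target. To obtain a Euclidean space, the multi-indices are
  enumerated by a finite type; for each \<open>q\<close> there is such a type of the right cardinality.\<close>

type_synonym ('m, 'j) jet = "(real ^ 'm) \<times> ((real ^ 'm) ^ 'j)"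

definition jet_index :: "nat \<Rightarrow> ('j::finite \<Rightarrow> 'm multiset) \<Rightarrow> bool" where
  "jet_index q idx \<longleftrightarrow> bij_betw idx UNIV {\<mu>. size \<mu> \<le> q}"

definition derivs ::
  "('j::finite \<Rightarrow> 'm multiset) \<Rightarrow> (real ^ 'm \<Rightarrow> real ^ 'm) \<Rightarrow> real ^ 'm \<Rightarrow> (real ^ 'm) ^ 'j" where
  "derivs idx f y = (\<chi> j. multi_partial (idx j) f y)"

definition jet ::
  "('j::finite \<Rightarrow> 'm multiset) \<Rightarrow> (real ^ 'm \<Rightarrow> real ^ 'm) \<Rightarrow> real ^ 'm \<Rightarrow> ('m, 'j) jet"
  where "jet idx f y = (y, derivs idx f y)"

text \<open>The jets of local transformations, that is, the open set of the jet space given by source and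
  target in \<^term>\<open>Y\<close> and (for \<open>q \<ge> 1\<close>) nonvanishing Jacobian determinant.\<close>

definition invertible_jets ::
  "('j::finite \<Rightarrow> 'm multiset) \<Rightarrow> (real ^ 'm) set \<Rightarrow> ('m, 'j) jet set" where
  "invertible_jets idx Y = {jet idx f y | S f y. (S, f) \<in> aut Y \<and> y \<in> S}"


subsection \<open>Lie pseudogroups\<close>

text \<open>The finitely many scalar equations of the system \<open>\<Phi> = 0\<close> are the components of a smooth
  function \<open>\<Phi>\<close> on the invertible jets, with values in a Euclidean space.\<close>

definition finite_solutions ::
  "(real ^ 'm) set \<Rightarrow> ('j::finite \<Rightarrow> 'm multiset) \<Rightarrow>
   (('m, 'j) jet \<Rightarrow> 'e::euclidean_space) \<Rightarrow>
   'm local_map set" where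
  "finite_solutions Y idx \<Phi> = {(S, f). (S, f) \<in> aut Y \<and> (\<forall>y\<in>S. \<Phi> (jet idx f y) = 0)}"

definition lie_pseudogroup ::
  "(real ^ 'm) set \<Rightarrow> nat \<Rightarrow> ('j::finite \<Rightarrow> 'm multiset) \<Rightarrow>
   (('m, 'j) jet \<Rightarrow> 'e::euclidean_space) \<Rightarrow>
   'm local_map set \<Rightarrow> bool" where
  "lie_pseudogroup Y q idx \<Phi> \<Gamma> \<longleftrightarrow>
     open Y \<and> jet_index q idx \<and> smooth_on (invertible_jets idx Y) \<Phi> \<and>
     \<Gamma> = finite_solutions Y idx \<Phi> \<and>
     (Y, \<lambda>y. y) \<in> \<Gamma> \<and>
     (\<forall>S f T h. (S, f) \<in> \<Gamma> \<longrightarrow> (T, h) \<in> \<Gamma> \<longrightarrow> (S \<inter> f -` T, h \<circ> f) \<in> \<Gamma>) \<and>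
     (\<forall>S f. (S, f) \<in> \<Gamma> \<longrightarrow> (f ` S, inv_into S f) \<in> \<Gamma>)"

text \<open>Linearization at the jet of the identity: for \<open>z = y + t \<xi>(y)\<close> the source \<open>y\<close> of the jet does
  not vary with \<open>t\<close>, hence the component \<open>0\<close> of the tangent vector. The sheaf is given by its
  sections over open sets.\<close>

definition infinitesimal_solutions ::
  "(real ^ 'm) set \<Rightarrow> ('j::finite \<Rightarrow> 'm multiset) \<Rightarrow>
   (('m, 'j) jet \<Rightarrow> 'e::euclidean_space) \<Rightarrow>
   'm local_map set" where
  "infinitesimal_solutions Y idx \<Phi> =
     {(S, \<xi>). open S \<and> S \<subseteq> Y \<and> smooth_on S \<xi> \<and>
        (\<forall>y\<in>S. frechet_derivative \<Phi> (at (jet idx (\<lambda>y. y) y)) (0, derivs idx \<xi> y) = 0)}"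


subsection \<open>Families of sections\<close>

definition pseudogroup_section ::
  "'m local_map set \<Rightarrow> (real ^ 'n) set \<Rightarrow>
   ((real ^ 'm) \<times> (real ^ 'n)) set \<Rightarrow> (real ^ 'm \<Rightarrow> real ^ 'n \<Rightarrow> real ^ 'm) \<Rightarrow> bool" where
  "pseudogroup_section \<Gamma> X U f \<longleftrightarrow>
     open U \<and> snd ` U \<subseteq> X \<and> smooth_on U (\<lambda>(y, x). f y x) \<and>
     (\<forall>x\<in>X. ({y. (y, x) \<in> U}, \<lambda>y. f y x) \<in> \<Gamma>)"

definition section_family ::
  "'m local_map set \<Rightarrow> (real ^ 'n) set \<Rightarrow>
   ((real ^ 'm) \<times> (real ^ 'n) \<times> real) set \<Rightarrow> (real ^ 'm \<Rightarrow> real ^ 'n \<Rightarrow> real \<Rightarrow> real ^ 'm) \<Rightarrow> bool"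
  where
  "section_family \<Gamma> X W f \<longleftrightarrow>
     open W \<and> smooth_on W (\<lambda>(y, x, \<epsilon>). f y x \<epsilon>) \<and>
     (\<forall>\<epsilon>. pseudogroup_section \<Gamma> X {(y, x). (y, x, \<epsilon>) \<in> W} (\<lambda>y x. f y x \<epsilon>))"

definition inverse_family ::
  "((real ^ 'm) \<times> (real ^ 'n) \<times> real) set \<Rightarrow> (real ^ 'm \<Rightarrow> real ^ 'n \<Rightarrow> real \<Rightarrow> real ^ 'm) \<Rightarrow>
   (real ^ 'm \<Rightarrow> real ^ 'n \<Rightarrow> real \<Rightarrow> real ^ 'm) \<Rightarrow> bool" where
  "inverse_family W f g \<longleftrightarrow>
     smooth_on {(f y x \<epsilon>, x, \<epsilon>) | y x \<epsilon>. (y, x, \<epsilon>) \<in> W} (\<lambda>(z, x, \<epsilon>). g z x \<epsilon>) \<and>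
     (\<forall>(y, x, \<epsilon>)\<in>W. g (f y x \<epsilon>) x \<epsilon> = y)"

definition vertical_field ::
  "'m local_map set \<Rightarrow> (real ^ 'n) set \<Rightarrow>
   ((real ^ 'm) \<times> (real ^ 'n)) set \<Rightarrow> (real ^ 'm \<Rightarrow> real ^ 'n \<Rightarrow> real ^ 'm) \<Rightarrow> bool" where
  "vertical_field \<Theta> X U \<xi> \<longleftrightarrow>
     smooth_on U (\<lambda>(y, x). \<xi> y x) \<and> (\<forall>x\<in>X. ({y. (y, x) \<in> U}, \<lambda>y. \<xi> y x) \<in> \<Theta>)"

text \<open>The matrix with entries \<open>v\<^sup>k\<^sub>i\<close>, the row index being \<open>k\<close>.\<close>

definition generalized_speed ::
  "(real ^ 'm \<Rightarrow> real ^ 'n \<Rightarrow> real ^ 'm) \<Rightarrow> (real ^ 'm \<Rightarrow> real ^ 'n \<Rightarrow> real ^ 'm) \<Rightarrow>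
   real ^ 'm \<Rightarrow> real ^ 'n \<Rightarrow> real ^ 'n ^ 'm" where
  "generalized_speed f g z x = jacobian (\<lambda>x'. f (g z x) x') (at x)"

end

theory Submission
  imports Defs
begin

text \<open>Fix \<open>\<epsilon>\<close> and consider the transformations \<open>f\<^sub>\<epsilon>\<inverse> \<circ> f\<^sub>t\<close> of \<open>Y\<close>, for fixed \<open>x\<close>. They belong to
  \<open>\<Gamma>\<close>, they are the identity for \<open>t = \<epsilon>\<close>, and their velocity at \<open>t = \<epsilon>\<close> is
  \<open>(\<partial>f/\<partial>y)\<inverse> \<delta>f = \<xi>\<close> (\<open>field_eq_derivative_of_comparison\<close>). Differentiating the finite Lie equations
  along this curve gives the linearized equations for \<open>\<xi>\<close>
  (\<open>linearized_equation_of_deformation_of_identity\<close>), provided that the derivative in \<open>t\<close> commutes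
  with the derivatives in \<open>y\<close> that make up a jet; and \<open>\<xi>\<close> is smooth as a derivative of a smooth
  function of \<open>(y, x, t)\<close>.

  For the speed, regard \<open>f\<close> as a function of \<open>(y, x, \<epsilon>)\<close>. The definition of \<open>\<xi>\<close> says that the field
  \<open>\<zeta> = (- \<xi>, 0, 1)\<close> is annihilated by the derivative \<open>Df\<close>. If \<open>z\<close> and \<open>x\<close> are kept fixed, the point
  \<open>(g, x, \<epsilon>)\<close> moves with velocity \<open>\<zeta>\<close>, so that \<open>\<delta>v\<close> is the derivative of \<open>\<partial>f/\<partial>x\<close> in the direction
  \<open>\<zeta>\<close>. Differentiating \<open>Df(\<zeta>) = 0\<close> with respect to \<open>x\<close> and exchanging the two derivatives of \<open>f\<close>
  gives \<open>\<delta>v = - Df(\<partial>\<zeta>/\<partial>x) = (\<partial>f/\<partial>y) (\<partial>\<xi>/\<partial>x)\<close> (\<open>speed_has_vector_derivative\<close>).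

  Both halves rest on the symmetry of second derivatives (\<open>directional_deriv_commute\<close>) and on the
  closure of smooth functions under composition (\<open>smooth_on_compose\<close>). The image of
  \<open>(y, x, \<epsilon>) \<mapsto> (f, x, \<epsilon>)\<close> is open by invariance of domain, so that \<open>g\<close> can be differentiated
  there.\<close>

section \<open>Smooth functions and their directional derivatives\<close>

definition directional_deriv :: "'a::real_normed_vector \<Rightarrow> ('a \<Rightarrow> 'b::real_normed_vector) \<Rightarrow> 'a \<Rightarrow> 'b" where
  "directional_deriv v f x = frechet_derivative f (at x) v"

lemma Ck_on_Suc_directional:
  "Ck_on (Suc k) S f \<longleftrightarrow>
     (\<forall>x\<in>S. f differentiable (at x)) \<and> (\<forall>v. Ck_on k S (directional_deriv v f))"
  by (simp add: directional_deriv_def[abs_def])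

declare Ck_on.simps(2) [simp del]

lemma directional_deriv_eq:
  assumes "(f has_derivative f') (at x)"
  shows "directional_deriv v f x = f' v"
  using frechet_derivative_at[OF assms] by (simp add: directional_deriv_def)

lemma has_derivative_directional:
  assumes "f differentiable (at x)"
  shows "(f has_derivative (\<lambda>v. directional_deriv v f x)) (at x)"
  using assms by (simp add: directional_deriv_def frechet_derivative_works)

lemma directional_deriv_cong:
  assumes "open S" "x \<in> S" "\<And>y. y \<in> S \<Longrightarrow> f y = g y"
  shows "directional_deriv v f x = directional_deriv v g x"
proof -
  have "(f has_derivative f') (at x) \<longleftrightarrow> (g has_derivative f') (at x)" for f'
    using assms has_derivative_transform_within_open[of _ f' x UNIV S] by metis
  then show ?thesis
    by (simp add: directional_deriv_def frechet_derivative_def)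
qed

lemma differentiable_cong_open:
  assumes "open S" "x \<in> S" "\<And>y. y \<in> S \<Longrightarrow> f y = g y" "f differentiable (at x)"
  shows "g differentiable (at x)"
  using assms has_derivative_transform_within_open[of f _ x UNIV S g]
  unfolding differentiable_def by blast

lemma Ck_on_cong:
  assumes "open S" "\<And>y. y \<in> S \<Longrightarrow> f y = g y" "Ck_on k S f"
  shows "Ck_on k S g"
  using assms
proof (induction k arbitrary: f g)
  case 0
  then show ?case using continuous_on_cong[of S S f g] by simp
next
  case (Suc k)
  have "Ck_on k S (directional_deriv v g)" for v
    using Suc.IH[OF Suc.prems(1), of "directional_deriv v f" "directional_deriv v g"] Suc.prems
      directional_deriv_cong[of S _ f g v]
    by (auto simp: Ck_on_Suc_directional)
  then show ?case
    using Suc.prems differentiable_cong_open[of S _ f g] by (auto simp: Ck_on_Suc_directional)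
qed

lemma Ck_on_SucD: "Ck_on (Suc k) S f \<Longrightarrow> Ck_on k S f"
proof (induction k arbitrary: f)
  case 0
  then show ?case
    by (auto simp: Ck_on_Suc_directional intro!: continuous_at_imp_continuous_on
        differentiable_imp_continuous_within)
next
  case (Suc k)
  then show ?case by (subst Ck_on_Suc_directional) (simp add: Ck_on_Suc_directional[of "Suc k"])
qed

lemma Ck_on_subset: "Ck_on k S f \<Longrightarrow> T \<subseteq> S \<Longrightarrow> Ck_on k T f"
proof (induction k arbitrary: f)
  case 0
  then show ?case using continuous_on_subset by auto
next
  case (Suc k)
  then show ?case by (auto simp: Ck_on_Suc_directional)
qed

lemma Ck_on_const: "Ck_on k S (\<lambda>x. c)"
proof (induction k arbitrary: c)
  case (Suc k)
  have "directional_deriv v (\<lambda>x. c) = (\<lambda>x. 0)" for v :: 'a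
    by (simp add: directional_deriv_def fun_eq_iff)
  then show ?case using Suc by (simp add: Ck_on_Suc_directional)
qed simp

lemma Ck_on_bounded_linear_image:
  assumes "open S" "bounded_linear L" "Ck_on k S f"
  shows "Ck_on k S (\<lambda>x. L (f x))"
  using assms
proof (induction k arbitrary: f)
  case 0
  then show ?case by (auto intro: bounded_linear.continuous_on)
next
  case (Suc k)
  have D: "((\<lambda>x. L (f x)) has_derivative (\<lambda>v. L (directional_deriv v f x))) (at x)" if "x \<in> S" for x
    using bounded_linear.has_derivative[OF Suc.prems(2) has_derivative_directional] Suc.prems that
    by (auto simp: Ck_on_Suc_directional)
  have "Ck_on k S (directional_deriv v (\<lambda>x. L (f x)))" for v
    by (rule Ck_on_cong[of S "\<lambda>x. L (directional_deriv v f x)"])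
      (use Suc directional_deriv_eq[OF D] in \<open>auto simp: Ck_on_Suc_directional\<close>)
  then show ?case using D by (auto simp: Ck_on_Suc_directional differentiable_def)
qed

lemma Ck_on_add:
  assumes "open S" "Ck_on k S f" "Ck_on k S g"
  shows "Ck_on k S (\<lambda>x. f x + g x)"
  using assms
proof (induction k arbitrary: f g)
  case 0
  then show ?case by (auto intro: continuous_intros)
next
  case (Suc k)
  have D: "((\<lambda>x. f x + g x) has_derivative
      (\<lambda>v. directional_deriv v f x + directional_deriv v g x)) (at x)" if "x \<in> S" for x
    by (rule has_derivative_add[OF has_derivative_directional has_derivative_directional])
      (use Suc.prems that in \<open>auto simp: Ck_on_Suc_directional\<close>)
  have "Ck_on k S (directional_deriv v (\<lambda>x. f x + g x))" for v
    by (rule Ck_on_cong[of S "\<lambda>x. directional_deriv v f x + directional_deriv v g x"])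
      (use Suc directional_deriv_eq[OF D] in \<open>auto simp: Ck_on_Suc_directional\<close>)
  then show ?case using D by (auto simp: Ck_on_Suc_directional differentiable_def)
qed

lemma Ck_on_sum:
  assumes "open S" "\<And>i. i \<in> I \<Longrightarrow> Ck_on k S (f i)"
  shows "Ck_on k S (\<lambda>x. \<Sum>i\<in>I. f i x)"
  using assms(2)
  by (induction I rule: infinite_finite_induct) (auto intro: Ck_on_const Ck_on_add assms(1))

lemma Ck_on_scaleR:
  assumes "open S" "Ck_on k S a" "Ck_on k S f"
  shows "Ck_on k S (\<lambda>x. a x *\<^sub>R f x)"
  using assms
proof (induction k arbitrary: a f)
  case 0
  then show ?case by (auto intro: continuous_intros)
next
  case (Suc k)
  have D: "((\<lambda>x. a x *\<^sub>R f x) has_derivative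
      (\<lambda>v. a x *\<^sub>R directional_deriv v f x + directional_deriv v a x *\<^sub>R f x)) (at x)"
    if "x \<in> S" for x
    by (rule has_derivative_scaleR[OF has_derivative_directional has_derivative_directional])
      (use Suc.prems that in \<open>auto simp: Ck_on_Suc_directional\<close>)
  have "Ck_on k S (directional_deriv v (\<lambda>x. a x *\<^sub>R f x))" for v
  proof (rule Ck_on_cong[OF Suc.prems(1)])
    show "a x *\<^sub>R directional_deriv v f x + directional_deriv v a x *\<^sub>R f x =
      directional_deriv v (\<lambda>x. a x *\<^sub>R f x) x" if "x \<in> S" for x
      using directional_deriv_eq[OF D[OF that]] by simp
    show "Ck_on k S (\<lambda>x. a x *\<^sub>R directional_deriv v f x + directional_deriv v a x *\<^sub>R f x)"
      using Suc.prems Ck_on_SucD[OF Suc.prems(2)] Ck_on_SucD[OF Suc.prems(3)]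
      by (intro Ck_on_add Suc.IH) (auto simp: Ck_on_Suc_directional)
  qed
  then show ?case using D by (auto simp: Ck_on_Suc_directional differentiable_def)
qed

lemma directional_deriv_sum_Basis:
  fixes f :: "'a::euclidean_space \<Rightarrow> 'b::real_normed_vector"
  assumes "f differentiable (at x)"
  shows "directional_deriv v f x = (\<Sum>b\<in>Basis. (v \<bullet> b) *\<^sub>R directional_deriv b f x)"
proof -
  have lin: "linear (\<lambda>v. directional_deriv v f x)"
    by (rule has_derivative_linear[OF has_derivative_directional[OF assms]])
  have "directional_deriv v f x = directional_deriv (\<Sum>b\<in>Basis. (v \<bullet> b) *\<^sub>R b) f x"
    by (simp only: euclidean_representation)
  also have "\<dots> = (\<Sum>b\<in>Basis. (v \<bullet> b) *\<^sub>R directional_deriv b f x)"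
    by (simp only: linear_sum[OF lin] linear_scale[OF lin])
  finally show ?thesis .
qed

text \<open>The derivative of \<open>g\<close> is taken at the varying point \<open>f x\<close> in the varying direction
  \<open>Df(x) v\<close>, whereas \<^const>\<open>Ck_on\<close> speaks of fixed directions only. Expanding the direction in a basis,
  which is why the middle space is Euclidean, gives products of functions of class \<open>C\<^sup>k\<close>.\<close>

lemma Ck_on_compose:
  fixes f :: "'a::real_normed_vector \<Rightarrow> 'b::euclidean_space"
    and g :: "'b \<Rightarrow> 'c::real_normed_vector"
  assumes "open S" "f ` S \<subseteq> T" "Ck_on k S f" "Ck_on k T g"
  shows "Ck_on k S (\<lambda>x. g (f x))"
  using assms
proof (induction k arbitrary: g)
  case 0
  then show ?case using continuous_on_compose2[of T g S f] by auto
next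
  case (Suc k)
  have D: "((\<lambda>x. g (f x)) has_derivative
      (\<lambda>v. directional_deriv (directional_deriv v f x) g (f x))) (at x)" if "x \<in> S" for x
    by (rule has_derivative_compose[OF has_derivative_directional has_derivative_directional])
      (use Suc.prems that in \<open>auto simp: Ck_on_Suc_directional\<close>)
  have "Ck_on k S (directional_deriv v (\<lambda>x. g (f x)))" for v
  proof (rule Ck_on_cong[OF Suc.prems(1)])
    show "(\<Sum>b\<in>Basis. (directional_deriv v f x \<bullet> b) *\<^sub>R directional_deriv b g (f x)) =
      directional_deriv v (\<lambda>x. g (f x)) x" if "x \<in> S" for x
      using directional_deriv_eq[OF D[OF that], of v] Suc.prems that
        directional_deriv_sum_Basis[of g "f x" "directional_deriv v f x"]
      by (auto simp: Ck_on_Suc_directional)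
    show "Ck_on k S (\<lambda>x. \<Sum>b\<in>Basis. (directional_deriv v f x \<bullet> b) *\<^sub>R directional_deriv b g (f x))"
      using Suc.prems Ck_on_SucD[OF Suc.prems(3)]
      by (intro Ck_on_sum Ck_on_scaleR Suc.IH Ck_on_bounded_linear_image[where L = "\<lambda>x. x \<bullet> _"] bounded_linear_inner_left)
        (auto simp: Ck_on_Suc_directional)
  qed
  then show ?case using D by (auto simp: Ck_on_Suc_directional differentiable_def)
qed

lemma Ck_on_ident: "Ck_on k S (\<lambda>x. x)"
proof (cases k)
  case (Suc l)
  have "directional_deriv v (\<lambda>x. x) = (\<lambda>x. v)" for v :: 'a
    by (simp add: directional_deriv_def fun_eq_iff)
  then show ?thesis by (simp add: Suc Ck_on_Suc_directional Ck_on_const)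
qed simp

lemma Ck_on_Pair:
  assumes "open S" "Ck_on k S f" "Ck_on k S g"
  shows "Ck_on k S (\<lambda>x. (f x, g x))"
proof -
  have "bounded_linear (\<lambda>a::'b. (a, 0::'c))" "bounded_linear (\<lambda>b::'c. (0::'b, b))"
    by (auto intro: bounded_linear_Pair bounded_linear_ident bounded_linear_zero)
  from Ck_on_add[OF assms(1) Ck_on_bounded_linear_image[OF assms(1) this(1) assms(2)]
      Ck_on_bounded_linear_image[OF assms(1) this(2) assms(3)]]
  show ?thesis by simp
qed

lemma smooth_on_differentiable: "smooth_on S f \<Longrightarrow> x \<in> S \<Longrightarrow> f differentiable (at x)"
  unfolding smooth_on_def by (metis Ck_on_Suc_directional)

lemma smooth_on_directional_deriv: "smooth_on S f \<Longrightarrow> smooth_on S (directional_deriv v f)"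
  unfolding smooth_on_def by (metis Ck_on_Suc_directional)

lemma smooth_on_subset: "smooth_on S f \<Longrightarrow> T \<subseteq> S \<Longrightarrow> smooth_on T f"
  unfolding smooth_on_def using Ck_on_subset by blast

lemma smooth_on_cong: "open S \<Longrightarrow> (\<And>y. y \<in> S \<Longrightarrow> f y = g y) \<Longrightarrow> smooth_on S f \<Longrightarrow> smooth_on S g"
  unfolding smooth_on_def using Ck_on_cong by blast

lemma smooth_on_const: "smooth_on S (\<lambda>x. c)"
  by (simp add: smooth_on_def Ck_on_const)

lemma smooth_on_bounded_linear: "open S \<Longrightarrow> bounded_linear L \<Longrightarrow> smooth_on S L"
  using Ck_on_bounded_linear_image[OF _ _ Ck_on_ident] by (auto simp: smooth_on_def)

lemma smooth_on_Pair:
  "open S \<Longrightarrow> smooth_on S f \<Longrightarrow> smooth_on S g \<Longrightarrow> smooth_on S (\<lambda>x. (f x, g x))"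
  by (simp add: smooth_on_def Ck_on_Pair)

lemma smooth_on_compose:
  fixes f :: "'a::real_normed_vector \<Rightarrow> 'b::euclidean_space"
  assumes "smooth_on T g" "open S" "smooth_on S f" "\<And>x. x \<in> S \<Longrightarrow> f x \<in> T"
  shows "smooth_on S (\<lambda>x. g (f x))"
  unfolding smooth_on_def
proof
  fix k
  show "Ck_on k S (\<lambda>x. g (f x))"
    by (rule Ck_on_compose[of S f T]) (use assms in \<open>auto simp: smooth_on_def\<close>)
qed

lemma smooth_on_continuous_on: "smooth_on S f \<Longrightarrow> continuous_on S f"
  unfolding smooth_on_def by (metis Ck_on.simps(1))

section \<open>Symmetry of second derivatives\<close>

lemma has_vector_derivative_along_curve:
  assumes "(c has_vector_derivative c') (at t)" "f differentiable (at (c t))"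
  shows "((\<lambda>t. f (c t)) has_vector_derivative directional_deriv c' f (c t)) (at t)"
proof -
  note D = has_derivative_directional[OF assms(2)]
  have "((\<lambda>t. f (c t)) has_derivative (\<lambda>r. directional_deriv (r *\<^sub>R c') f (c t))) (at t)"
    by (rule has_derivative_compose[where f = c, OF _ D]) (use assms(1) in \<open>simp add: has_vector_derivative_def\<close>)
  then show ?thesis
    by (simp add: has_vector_derivative_def linear_scale[OF has_derivative_linear[OF D]])
qed

text \<open>The second difference is \<open>F s - F 0\<close> for \<open>F a = f (p + a u + s w) - f (p + a u)\<close>, so the mean
  value theorem applies once in the direction \<open>u\<close> and then once in the direction \<open>w\<close>. It takes real
  values because the mean value theorem fails for vector-valued functions.\<close>

lemma second_difference_mean_value:
  fixes f :: "'a::real_normed_vector \<Rightarrow> real"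
  assumes s: "0 < s"
    and D: "\<And>a b. 0 \<le> a \<Longrightarrow> a \<le> s \<Longrightarrow> 0 \<le> b \<Longrightarrow> b \<le> s \<Longrightarrow>
      f differentiable (at (p + a *\<^sub>R u + b *\<^sub>R w)) \<and>
      directional_deriv u f differentiable (at (p + a *\<^sub>R u + b *\<^sub>R w))"
  obtains a b where "0 < a" "a < s" "0 < b" "b < s"
    "f (p + s *\<^sub>R u + s *\<^sub>R w) - f (p + s *\<^sub>R u) - f (p + s *\<^sub>R w) + f p =
      s\<^sup>2 * directional_deriv w (directional_deriv u f) (p + a *\<^sub>R u + b *\<^sub>R w)"
proof -
  have Du: "((\<lambda>a. f (p + a *\<^sub>R u + b *\<^sub>R w)) has_real_derivative
      directional_deriv u f (p + a *\<^sub>R u + b *\<^sub>R w)) (at a)"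
    if "0 \<le> a" "a \<le> s" "0 \<le> b" "b \<le> s" for a b
  proof -
    have "((\<lambda>a. p + a *\<^sub>R u + b *\<^sub>R w) has_vector_derivative u) (at a)"
      by (auto intro!: derivative_eq_intros)
    from has_vector_derivative_along_curve[OF this D[OF that, THEN conjunct1]] show ?thesis
      by (simp add: has_real_derivative_iff_has_vector_derivative)
  qed
  have Dw: "((\<lambda>b. directional_deriv u f (p + a *\<^sub>R u + b *\<^sub>R w)) has_real_derivative
      directional_deriv w (directional_deriv u f) (p + a *\<^sub>R u + b *\<^sub>R w)) (at b)"
    if "0 \<le> a" "a \<le> s" "0 \<le> b" "b \<le> s" for a b
  proof -
    have "((\<lambda>b. p + a *\<^sub>R u + b *\<^sub>R w) has_vector_derivative w) (at b)"
      by (auto intro!: derivative_eq_intros)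
    from has_vector_derivative_along_curve[OF this D[OF that, THEN conjunct2]] show ?thesis
      by (simp add: has_real_derivative_iff_has_vector_derivative)
  qed
  obtain a where a: "0 < a" "a < s"
    "(f (p + s *\<^sub>R u + s *\<^sub>R w) - f (p + s *\<^sub>R u + 0 *\<^sub>R w)) -
     (f (p + 0 *\<^sub>R u + s *\<^sub>R w) - f (p + 0 *\<^sub>R u + 0 *\<^sub>R w)) =
     (s - 0) * (directional_deriv u f (p + a *\<^sub>R u + s *\<^sub>R w) - directional_deriv u f (p + a *\<^sub>R u + 0 *\<^sub>R w))"
    using MVT2[OF s DERIV_diff[OF Du[where b = s] Du[where b = 0]]] s by force
  obtain b where b: "0 < b" "b < s"
    "directional_deriv u f (p + a *\<^sub>R u + s *\<^sub>R w) - directional_deriv u f (p + a *\<^sub>R u + 0 *\<^sub>R w) =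
     (s - 0) * directional_deriv w (directional_deriv u f) (p + a *\<^sub>R u + b *\<^sub>R w)"
    using MVT2[OF s Dw[of a]] a by force
  show thesis
    by (rule that[OF a(1,2) b(1,2)]) (use a(3) b(3) in \<open>simp add: power2_eq_square\<close>)
qed

text \<open>The second difference is symmetric in \<open>u\<close> and \<open>w\<close>, so the two mixed derivatives take a common
  value at two points of an arbitrarily small parallelogram at \<open>p\<close>; continuity then identifies
  their values at \<open>p\<close>.\<close>

lemma directional_deriv_commute_real:
  fixes f :: "'a::real_normed_vector \<Rightarrow> real"
  assumes S: "open S" and f: "Ck_on 2 S f" and p: "p \<in> S"
  shows "directional_deriv u (directional_deriv w f) p = directional_deriv w (directional_deriv u f) p"
    (is "?A p = ?B p")
proof (rule ccontr)
  assume "?A p \<noteq> ?B p"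
  define e where "e = \<bar>?A p - ?B p\<bar> / 2"
  have e: "e > 0" using \<open>?A p \<noteq> ?B p\<close> by (simp add: e_def)
  have C2: "f differentiable (at x)" "directional_deriv v f differentiable (at x)" if "x \<in> S" for x v
    using f that by (auto simp: numeral_2_eq_2 Ck_on_Suc_directional)
  have "continuous_on S ?A" "continuous_on S ?B"
    using f by (auto simp: numeral_2_eq_2 Ck_on_Suc_directional)
  then have "isCont ?A p" "isCont ?B p"
    using S p by (auto simp: continuous_on_eq_continuous_at)
  then obtain d1 d2 where d1: "d1 > 0" "\<And>x. dist x p < d1 \<Longrightarrow> \<bar>?A x - ?A p\<bar> < e"
    and d2: "d2 > 0" "\<And>x. dist x p < d2 \<Longrightarrow> \<bar>?B x - ?B p\<bar> < e"
    using e unfolding continuous_at_eps_delta dist_real_def by metis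
  obtain d3 where d3: "d3 > 0" "ball p d3 \<subseteq> S" using S p openE by blast
  define d where "d = min d1 (min d2 d3)"
  \<comment> \<open>The parallelogram of side parameter \<open>s\<close> has to fit into the ball of radius \<open>d\<close>.\<close>
  define s where "s = d / (norm u + norm w + 1) / 2"
  have "d > 0" using d1 d2 d3 by (simp add: d_def)
  have N: "norm u + norm w + 1 > 0" by (simp add: add_nonneg_pos)
  have s: "s > 0" using \<open>d > 0\<close> N by (simp add: s_def)
  have sN: "s * (norm u + norm w) < d"
  proof -
    have "s * (norm u + norm w) \<le> s * (norm u + norm w + 1)" using s by simp
    also have "\<dots> = d / 2" using N by (simp add: s_def field_simps)
    finally show ?thesis using \<open>d > 0\<close> by simp
  qed
  have near: "dist (p + a *\<^sub>R u + b *\<^sub>R w) p < d" if "0 \<le> a" "a \<le> s" "0 \<le> b" "b \<le> s" for a b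
  proof -
    have "norm (a *\<^sub>R u + b *\<^sub>R w) \<le> a * norm u + b * norm w"
      using norm_triangle_ineq[of "a *\<^sub>R u" "b *\<^sub>R w"] that by simp
    also have "\<dots> \<le> s * norm u + s * norm w"
      using that by (intro add_mono mult_right_mono) auto
    finally show ?thesis using sN by (simp add: dist_norm algebra_simps)
  qed
  have inS: "p + a *\<^sub>R u + b *\<^sub>R w \<in> S" if "0 \<le> a" "a \<le> s" "0 \<le> b" "b \<le> s" for a b
    using near[OF that] d3 by (auto simp: d_def subset_iff dist_commute)
  obtain a b where ab: "0 < a" "a < s" "0 < b" "b < s"
    "f (p + s *\<^sub>R u + s *\<^sub>R w) - f (p + s *\<^sub>R u) - f (p + s *\<^sub>R w) + f p =
      s\<^sup>2 * ?B (p + a *\<^sub>R u + b *\<^sub>R w)"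
    using second_difference_mean_value[OF s, of f p u w] C2 inS by metis
  have inS': "p + a *\<^sub>R w + b *\<^sub>R u \<in> S" if "0 \<le> a" "a \<le> s" "0 \<le> b" "b \<le> s" for a b
    using inS[of b a] that by (simp add: algebra_simps)
  obtain a' b' where ab': "0 < a'" "a' < s" "0 < b'" "b' < s"
    "f (p + s *\<^sub>R w + s *\<^sub>R u) - f (p + s *\<^sub>R w) - f (p + s *\<^sub>R u) + f p =
      s\<^sup>2 * ?A (p + a' *\<^sub>R w + b' *\<^sub>R u)"
    using second_difference_mean_value[OF s, of f p w u] C2 inS' by metis
  have swap: "p + s *\<^sub>R w + s *\<^sub>R u = p + s *\<^sub>R u + s *\<^sub>R w" "p + a' *\<^sub>R w + b' *\<^sub>R u = p + b' *\<^sub>R u + a' *\<^sub>R w"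
    by (simp_all add: algebra_simps)
  have "s\<^sup>2 * ?A (p + b' *\<^sub>R u + a' *\<^sub>R w) = s\<^sup>2 * ?B (p + a *\<^sub>R u + b *\<^sub>R w)"
    using ab(5) ab'(5) unfolding swap by linarith
  then have "?A (p + b' *\<^sub>R u + a' *\<^sub>R w) = ?B (p + a *\<^sub>R u + b *\<^sub>R w)" using s by simp
  moreover have "\<bar>?A (p + b' *\<^sub>R u + a' *\<^sub>R w) - ?A p\<bar> < e"
    using near[of b' a'] ab' by (intro d1(2)) (simp add: d_def)
  moreover have "\<bar>?B (p + a *\<^sub>R u + b *\<^sub>R w) - ?B p\<bar> < e"
    using near[of a b] ab by (intro d2(2)) (simp add: d_def)
  moreover have "\<bar>?A p - ?B p\<bar> \<le> \<bar>r - ?A p\<bar> + \<bar>r - ?B p\<bar>" for r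
    by linarith
  ultimately show False unfolding e_def by (metis add_strict_mono field_sum_of_halves not_less)
qed

lemma directional_deriv_bounded_linear:
  assumes "bounded_linear L" "f differentiable (at x)"
  shows "directional_deriv v (\<lambda>x. L (f x)) x = L (directional_deriv v f x)"
  by (rule directional_deriv_eq bounded_linear.has_derivative has_derivative_directional assms)+

lemma directional_deriv_commute:
  fixes f :: "'a::real_normed_vector \<Rightarrow> 'b::euclidean_space"
  assumes S: "open S" and f: "smooth_on S f" and p: "p \<in> S"
  shows "directional_deriv u (directional_deriv w f) p = directional_deriv w (directional_deriv u f) p"
proof (rule euclidean_eqI)
  fix b :: 'b
  have *: "directional_deriv u (directional_deriv w (\<lambda>x. f x \<bullet> b)) p =
      directional_deriv u (directional_deriv w f) p \<bullet> b" for u w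
  proof -
    have "directional_deriv u (directional_deriv w (\<lambda>x. f x \<bullet> b)) p =
        directional_deriv u (\<lambda>x. directional_deriv w f x \<bullet> b) p"
      by (rule directional_deriv_cong[OF S p])
        (rule directional_deriv_bounded_linear[OF bounded_linear_inner_left smooth_on_differentiable[OF f]])
    also have "\<dots> = directional_deriv u (directional_deriv w f) p \<bullet> b"
      using f p by (intro directional_deriv_bounded_linear[OF bounded_linear_inner_left]
          smooth_on_differentiable smooth_on_directional_deriv)
    finally show ?thesis .
  qed
  have "Ck_on 2 S (\<lambda>x. f x \<bullet> b)"
    using f by (intro Ck_on_bounded_linear_image[OF S bounded_linear_inner_left]) (simp add: smooth_on_def)
  from directional_deriv_commute_real[OF S this p, of u w] *
  show "directional_deriv u (directional_deriv w f) p \<bullet> b =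
      directional_deriv w (directional_deriv u f) p \<bullet> b" by simp
qed

section \<open>Partial derivatives and jets of one-parameter families\<close>

lemma directional_deriv_compose:
  assumes "(a has_derivative A) (at y)" "f differentiable (at (a y))"
  shows "directional_deriv v (\<lambda>y. f (a y)) y = directional_deriv (A v) f (a y)"
  by (rule directional_deriv_eq, rule has_derivative_compose[OF assms(1)],
      rule has_derivative_directional[OF assms(2)])

lemma partial_eq_directional_deriv: "partial i f = directional_deriv (axis i 1) f"
  by (simp add: partial_def directional_deriv_def fun_eq_iff)

lemma jacobian_mult_eq_directional_deriv:
  fixes f :: "real ^ 'a \<Rightarrow> real ^ 'b"
  assumes "f differentiable (at x)"
  shows "jacobian f (at x) *v h = directional_deriv h f x"
  using directional_deriv_eq[OF assms[unfolded jacobian_works]] by simp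

lemma jacobian_nth_eq_directional_deriv:
  "jacobian f (at x) $ k $ i = directional_deriv (axis i 1) f x $ k"
  by (simp add: jacobian_def matrix_def directional_deriv_def)

text \<open>A vector is the sum of the images of its components under the linear injections \<^const>\<open>axis\<close>.\<close>

lemma has_vector_derivative_vec:
  fixes f :: "real \<Rightarrow> 'a::euclidean_space ^ 'k"
  assumes "\<And>j. ((\<lambda>t. f t $ j) has_vector_derivative f' $ j) (at t)"
  shows "(f has_vector_derivative f') (at t)"
proof -
  have axis: "bounded_linear (axis j :: 'a \<Rightarrow> 'a ^ 'k)" for j
  proof -
    have "linear (axis j :: 'a \<Rightarrow> 'a ^ 'k)"
      by (rule linearI) (auto simp: vec_eq_iff axis_def)
    then show ?thesis by (simp add: linear_conv_bounded_linear)
  qed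
  have "((\<lambda>t. \<Sum>j\<in>UNIV. axis j (f t $ j)) has_vector_derivative (\<Sum>j\<in>UNIV. axis j (f' $ j))) (at t)"
    by (rule has_vector_derivative_sum, rule bounded_linear.has_vector_derivative[OF axis assms])
  moreover have "(\<Sum>j\<in>UNIV. axis j (x $ j)) = x" for x :: "'a ^ 'k"
    by (simp add: vec_eq_iff axis_def)
  ultimately show ?thesis by simp
qed

text \<open>Partial derivatives of a one-parameter family \<open>H (y, t)\<close> with respect to \<open>y\<close>, taken as directional
  derivatives in the product space: there the operator can be exchanged with the derivative in \<open>t\<close>.\<close>

definition joint_partials ::
  "'m list \<Rightarrow> ((real ^ 'm) \<times> real \<Rightarrow> 'c::real_normed_vector) \<Rightarrow> (real ^ 'm) \<times> real \<Rightarrow> 'c" where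
  "joint_partials L H = foldr (\<lambda>i. directional_deriv (axis i 1, 0)) L H"

lemma smooth_on_joint_partials: "smooth_on U H \<Longrightarrow> smooth_on U (joint_partials L H)"
  by (induction L) (simp_all add: joint_partials_def smooth_on_directional_deriv)

lemma directional_deriv_joint_partials:
  fixes H :: "(real ^ 'm) \<times> real \<Rightarrow> 'c::euclidean_space"
  assumes "open U" "smooth_on U H" "p \<in> U"
  shows "directional_deriv w (joint_partials L H) p = joint_partials L (directional_deriv w H) p"
  using assms(3)
proof (induction L arbitrary: p)
  case Nil
  then show ?case by (simp add: joint_partials_def)
next
  case (Cons i L)
  have "directional_deriv w (joint_partials (i # L) H) p =
      directional_deriv w (directional_deriv (axis i 1, 0) (joint_partials L H)) p"
    by (simp add: joint_partials_def)
  also have "\<dots> = directional_deriv (axis i 1, 0) (directional_deriv w (joint_partials L H)) p"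
    by (rule directional_deriv_commute[OF assms(1) smooth_on_joint_partials[OF assms(2)] Cons.prems])
  also have "\<dots> = directional_deriv (axis i 1, 0) (joint_partials L (directional_deriv w H)) p"
    by (rule directional_deriv_cong[OF assms(1) Cons.prems]) (rule Cons.IH)
  finally show ?case by (simp add: joint_partials_def)
qed

lemma iterated_partial_cong:
  assumes "open S" "\<And>y. y \<in> S \<Longrightarrow> f y = g y" "y \<in> S"
  shows "foldr partial L f y = foldr partial L g y"
  using assms(3)
proof (induction L arbitrary: y)
  case (Cons i L)
  have "directional_deriv (axis i 1) (foldr partial L f) y =
      directional_deriv (axis i 1) (foldr partial L g) y"
    by (rule directional_deriv_cong[OF assms(1) Cons.prems Cons.IH])
  then show ?case unfolding foldr.simps o_apply partial_eq_directional_deriv[of i] .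
qed (simp add: assms(2))

lemma derivs_cong:
  assumes "open S" "\<And>y. y \<in> S \<Longrightarrow> f y = g y" "y \<in> S"
  shows "derivs idx f y = derivs idx g y"
  unfolding derivs_def multi_partial_def using iterated_partial_cong[OF assms] by simp

lemma iterated_partial_slice:
  fixes H :: "(real ^ 'm) \<times> real \<Rightarrow> 'c::euclidean_space"
  assumes "open U" "smooth_on U H" "(y, t) \<in> U"
  shows "foldr partial L (\<lambda>y. H (y, t)) y = joint_partials L H (y, t)"
  using assms(3)
proof (induction L arbitrary: y)
  case Nil
  then show ?case by (simp add: joint_partials_def)
next
  case (Cons i L)
  let ?S = "{y. (y, t) \<in> U}"
  have "?S = (\<lambda>y. (y, t)) -` U" by auto
  then have S: "open ?S"
    using assms(1) by (simp add: open_vimage continuous_on_Pair)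
  have D: "((\<lambda>y. (y, t)) has_derivative (\<lambda>h. (h, 0))) (at y)"
    by (auto intro!: derivative_eq_intros)
  have "foldr partial (i # L) (\<lambda>y. H (y, t)) y =
      directional_deriv (axis i 1) (foldr partial L (\<lambda>y. H (y, t))) y"
    by (simp add: partial_eq_directional_deriv)
  also have "\<dots> = directional_deriv (axis i 1) (\<lambda>y. joint_partials L H (y, t)) y"
    by (rule directional_deriv_cong[OF S]) (use Cons in auto)
  also have "\<dots> = directional_deriv (axis i 1, 0) (joint_partials L H) (y, t)"
    by (rule directional_deriv_compose[OF D])
      (rule smooth_on_differentiable[OF smooth_on_joint_partials[OF assms(2)] Cons.prems])
  finally show ?case by (simp add: joint_partials_def)
qed

text \<open>Prolongation to jets commutes with differentiation in the parameter: it consists of derivatives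
  in \<open>y\<close>, which commute with the derivative in \<open>t\<close>.\<close>

lemma derivs_slice_has_vector_derivative:
  fixes H :: "(real ^ 'm) \<times> real \<Rightarrow> real ^ 'm" and idx :: "'j::finite \<Rightarrow> 'm multiset"
  assumes U: "open U" and H: "smooth_on U H" and p: "(y, t\<^sub>0) \<in> U"
  shows "((\<lambda>t. derivs idx (\<lambda>y. H (y, t)) y) has_vector_derivative
    derivs idx (\<lambda>y. directional_deriv (0, 1) H (y, t\<^sub>0)) y) (at t\<^sub>0)"
proof (rule has_vector_derivative_vec)
  fix j
  define L where "L = (SOME is. mset is = idx j)"
  have T: "open {t. (y, t) \<in> U}"
    using open_vimage[OF U, of "\<lambda>t. (y, t)"] by (simp add: vimage_def continuous_on_Pair)
  have "((\<lambda>t. (y, t)) has_vector_derivative (0, 1)) (at t\<^sub>0)"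
    by (auto intro!: has_vector_derivative_Pair derivative_eq_intros)
  from has_vector_derivative_along_curve[OF this smooth_on_differentiable[OF smooth_on_joint_partials[OF H]]] p
  have "((\<lambda>t. joint_partials L H (y, t)) has_vector_derivative
      directional_deriv (0, 1) (joint_partials L H) (y, t\<^sub>0)) (at t\<^sub>0)" by blast
  also have "directional_deriv (0, 1) (joint_partials L H) (y, t\<^sub>0) =
      foldr partial L (\<lambda>y. directional_deriv (0, 1) H (y, t\<^sub>0)) y"
    using directional_deriv_joint_partials[OF U H p]
      iterated_partial_slice[OF U smooth_on_directional_deriv[OF H] p] by simp
  finally have "((\<lambda>t. foldr partial L (\<lambda>y. H (y, t)) y) has_vector_derivative
      foldr partial L (\<lambda>y. directional_deriv (0, 1) H (y, t\<^sub>0)) y) (at t\<^sub>0)"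
    by (rule has_vector_derivative_transform_within_open[OF _ T])
      (use p iterated_partial_slice[OF U H] in auto)
  then show "((\<lambda>t. derivs idx (\<lambda>y. H (y, t)) y $ j) has_vector_derivative
      derivs idx (\<lambda>y. directional_deriv (0, 1) H (y, t\<^sub>0)) y $ j) (at t\<^sub>0)"
    by (simp add: derivs_def multi_partial_def L_def)
qed

text \<open>This is how finite equations yield infinitesimal ones: differentiate \<open>\<Phi> = 0\<close> at \<open>t\<^sub>0\<close> along the
  curve of jets \<open>t \<mapsto> jet (H (\<cdot>, t)) (y)\<close>, which passes through the jet of the identity and whose
  velocity is the prolongation of the initial velocity field.\<close>

lemma linearized_equation_of_deformation_of_identity:
  fixes H :: "(real ^ 'm) \<times> real \<Rightarrow> real ^ 'm" and idx :: "'j::finite \<Rightarrow> 'm multiset"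
    and \<Phi> :: "('m, 'j) jet \<Rightarrow> 'e::euclidean_space"
  assumes U: "open U" and H: "smooth_on U H" and p: "(y, t\<^sub>0) \<in> U"
    and \<Phi>: "\<Phi> differentiable (at (jet idx (\<lambda>y. y) y))"
    and equation: "\<And>t. (y, t) \<in> U \<Longrightarrow> \<Phi> (jet idx (\<lambda>y. H (y, t)) y) = 0"
    and identity: "\<And>y. (y, t\<^sub>0) \<in> U \<Longrightarrow> H (y, t\<^sub>0) = y"
  shows "frechet_derivative \<Phi> (at (jet idx (\<lambda>y. y) y))
    (0, derivs idx (\<lambda>y. directional_deriv (0, 1) H (y, t\<^sub>0)) y) = 0"
proof -
  have S: "open {y. (y, t\<^sub>0) \<in> U}" "open {t. (y, t) \<in> U}"
    using open_vimage[OF U, of "\<lambda>t. (y, t)"] open_vimage[OF U, of "\<lambda>y. (y, t\<^sub>0)"]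
    by (simp_all add: vimage_def continuous_on_Pair)
  have id: "jet idx (\<lambda>y. H (y, t\<^sub>0)) y = jet idx (\<lambda>y. y) y"
    unfolding jet_def using derivs_cong[OF S(1), of "\<lambda>y. H (y, t\<^sub>0)" "\<lambda>y. y"] identity p by simp
  have "((\<lambda>t. jet idx (\<lambda>y. H (y, t)) y) has_vector_derivative
      (0, derivs idx (\<lambda>y. directional_deriv (0, 1) H (y, t\<^sub>0)) y)) (at t\<^sub>0)"
    unfolding jet_def
    by (intro has_vector_derivative_Pair has_vector_derivative_const derivs_slice_has_vector_derivative[OF U H p])
  from has_vector_derivative_along_curve[OF this, of \<Phi>]
  have "((\<lambda>t. \<Phi> (jet idx (\<lambda>y. H (y, t)) y)) has_vector_derivative
      directional_deriv (0, derivs idx (\<lambda>y. directional_deriv (0, 1) H (y, t\<^sub>0)) y) \<Phi> (jet idx (\<lambda>y. y) y)) (at t\<^sub>0)"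
    using \<Phi> by (simp add: id)
  moreover have "((\<lambda>t. \<Phi> (jet idx (\<lambda>y. H (y, t)) y)) has_vector_derivative 0) (at t\<^sub>0)"
    by (rule has_vector_derivative_transform_within_open[OF has_vector_derivative_const S(2)])
      (use p equation in auto)
  ultimately show ?thesis
    unfolding directional_deriv_def by (rule vector_derivative_unique_at)
qed

section \<open>Differentiating along an annihilated field\<close>

text \<open>The key to the variational formula. Differentiate the relation \<open>D\<phi>(p + s u) \<zeta>(s) = 0\<close> at \<open>s = 0\<close>:
  by the product rule \<open>D\<^sup>2\<phi>(u, \<zeta>(0)) + D\<phi>(\<zeta>') = 0\<close>, and by symmetry the first term is the derivative
  of \<open>D\<phi>(u)\<close> along any curve that leaves \<open>p\<close> with velocity \<open>\<zeta>(0)\<close>.\<close>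

lemma derivative_of_partial_along_annihilated_velocity:
  fixes \<phi> :: "'a::euclidean_space \<Rightarrow> 'b::euclidean_space"
  assumes V: "open V" and \<phi>: "smooth_on V \<phi>" and p: "p \<in> V"
    and \<zeta>: "(\<zeta> has_vector_derivative \<zeta>') (at 0)"
    and annihilated: "\<And>s. p + s *\<^sub>R u \<in> V \<Longrightarrow> directional_deriv (\<zeta> s) \<phi> (p + s *\<^sub>R u) = 0"
    and c: "(c has_vector_derivative \<zeta> 0) (at t)" "c t = p"
  shows "((\<lambda>t. directional_deriv u \<phi> (c t)) has_vector_derivative - directional_deriv \<zeta>' \<phi> p) (at t)"
proof -
  have S: "open {s. p + s *\<^sub>R u \<in> V}"
    using open_vimage[OF V, of "\<lambda>s. p + s *\<^sub>R u"] by (simp add: vimage_def continuous_intros)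
  have expand: "directional_deriv v \<phi> q = (\<Sum>b\<in>Basis. (v \<bullet> b) *\<^sub>R directional_deriv b \<phi> q)" if "q \<in> V" for v q
    by (rule directional_deriv_sum_Basis[OF smooth_on_differentiable[OF \<phi> that]])
  have line: "((\<lambda>s. p + s *\<^sub>R u) has_vector_derivative u) (at 0)"
    by (auto intro!: derivative_eq_intros)
  have D: "((\<lambda>s. directional_deriv b \<phi> (p + s *\<^sub>R u)) has_vector_derivative
      directional_deriv u (directional_deriv b \<phi>) p) (at 0)" for b
    using has_vector_derivative_along_curve[OF line, of "directional_deriv b \<phi>"]
      smooth_on_differentiable[OF smooth_on_directional_deriv[OF \<phi>] p] by simp
  have "((\<lambda>s. \<Sum>b\<in>Basis. (\<zeta> s \<bullet> b) *\<^sub>R directional_deriv b \<phi> (p + s *\<^sub>R u)) has_vector_derivative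
      (\<Sum>b\<in>Basis. (\<zeta> 0 \<bullet> b) *\<^sub>R directional_deriv u (directional_deriv b \<phi>) p +
        (\<zeta>' \<bullet> b) *\<^sub>R directional_deriv b \<phi> (p + 0 *\<^sub>R u))) (at 0)"
    by (intro has_vector_derivative_sum has_vector_derivative_scaleR D)
      (simp add: has_real_derivative_iff_has_vector_derivative
        bounded_linear.has_vector_derivative[OF bounded_linear_inner_left \<zeta>])
  moreover have "((\<lambda>s. \<Sum>b\<in>Basis. (\<zeta> s \<bullet> b) *\<^sub>R directional_deriv b \<phi> (p + s *\<^sub>R u))
      has_vector_derivative 0) (at 0)"
    by (rule has_vector_derivative_transform_within_open[OF has_vector_derivative_const[of 0] S])
      (use p annihilated expand in auto)
  ultimately have "(\<Sum>b\<in>Basis. (\<zeta> 0 \<bullet> b) *\<^sub>R directional_deriv u (directional_deriv b \<phi>) p +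
        (\<zeta>' \<bullet> b) *\<^sub>R directional_deriv b \<phi> (p + 0 *\<^sub>R u)) = 0"
    by (rule vector_derivative_unique_at)
  then have zero: "(\<Sum>b\<in>Basis. (\<zeta> 0 \<bullet> b) *\<^sub>R directional_deriv u (directional_deriv b \<phi>) p) +
      directional_deriv \<zeta>' \<phi> p = 0"
    using expand[OF p, of \<zeta>'] by (simp add: sum.distrib)
  have "directional_deriv (\<zeta> 0) (directional_deriv u \<phi>) p =
      (\<Sum>b\<in>Basis. (\<zeta> 0 \<bullet> b) *\<^sub>R directional_deriv b (directional_deriv u \<phi>) p)"
    by (rule directional_deriv_sum_Basis[OF smooth_on_differentiable[OF smooth_on_directional_deriv[OF \<phi>] p]])
  also have "\<dots> = (\<Sum>b\<in>Basis. (\<zeta> 0 \<bullet> b) *\<^sub>R directional_deriv u (directional_deriv b \<phi>) p)"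
    using directional_deriv_commute[OF V \<phi> p] by metis
  also have "\<dots> = - directional_deriv \<zeta>' \<phi> p"
    using zero by (simp add: eq_neg_iff_add_eq_0)
  finally have "directional_deriv (\<zeta> 0) (directional_deriv u \<phi>) p = - directional_deriv \<zeta>' \<phi> p" .
  with has_vector_derivative_along_curve[OF c(1), of "directional_deriv u \<phi>"]
    smooth_on_differentiable[OF smooth_on_directional_deriv[OF \<phi>] p] c(2)
  show ?thesis by simp
qed

section \<open>Variations of a section\<close>

text \<open>Injectivity of the elements of \<open>\<Gamma>\<close> makes \<open>(y, x, \<epsilon>) \<mapsto> (f, x, \<epsilon>)\<close> injective on \<open>W\<close>. The
  points \<open>(y, x, \<epsilon>)\<close> and \<open>(z, x, \<epsilon>)\<close> are taken in one product space, so that all derivatives of the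
  family become directional derivatives of a single function, and symmetry of second derivatives
  applies to any two of them.\<close>

locale variation_of_section =
  fixes \<Gamma> :: "'m::finite local_map set" and X :: "(real ^ 'n::finite) set"
    and W :: "((real ^ 'm) \<times> (real ^ 'n) \<times> real) set"
    and f g \<xi> :: "real ^ 'm \<Rightarrow> real ^ 'n \<Rightarrow> real \<Rightarrow> real ^ 'm"
  assumes injective: "\<And>S h. (S, h) \<in> \<Gamma> \<Longrightarrow> inj_on h S"
    and family: "section_family \<Gamma> X W f"
    and inverse: "inverse_family W f g"
    and variation: "\<And>y x \<epsilon>. (y, x, \<epsilon>) \<in> W \<Longrightarrow>
      ((\<lambda>\<epsilon>'. f y x \<epsilon>') has_vector_derivative
        jacobian (\<lambda>y'. f y' x \<epsilon>) (at y) *v \<xi> y x \<epsilon>) (at \<epsilon>)"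
begin

definition total_map :: "(real ^ 'm) \<times> (real ^ 'n) \<times> real \<Rightarrow> real ^ 'm" where
  "total_map = (\<lambda>(y, x, \<epsilon>). f y x \<epsilon>)"

definition total_inverse :: "(real ^ 'm) \<times> (real ^ 'n) \<times> real \<Rightarrow> real ^ 'm" where
  "total_inverse = (\<lambda>(z, x, \<epsilon>). g z x \<epsilon>)"

definition target :: "((real ^ 'm) \<times> (real ^ 'n) \<times> real) set" where
  "target = (\<lambda>q. (total_map q, snd q)) ` W"

lemma target_iff: "(z, x, \<epsilon>) \<in> target \<longleftrightarrow> (\<exists>y. (y, x, \<epsilon>) \<in> W \<and> z = f y x \<epsilon>)"
  by (force simp: target_def total_map_def)

lemma open_W: "open W" and smooth_total_map: "smooth_on W total_map"
  using family by (auto simp: section_family_def total_map_def)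

lemma section_in_pseudogroup:
  assumes "x \<in> X"
  shows "({y. (y, x, \<epsilon>) \<in> W}, \<lambda>y. f y x \<epsilon>) \<in> \<Gamma>"
  using family assms unfolding section_family_def pseudogroup_section_def by auto

lemma parameter_in_X: "(y, x, \<epsilon>) \<in> W \<Longrightarrow> x \<in> X"
  using family unfolding section_family_def pseudogroup_section_def
  by (metis (mono_tags, lifting) case_prodI image_eqI mem_Collect_eq snd_conv subsetD)

lemma section_injective:
  assumes "(y, x, \<epsilon>) \<in> W" "(y', x, \<epsilon>) \<in> W" "f y x \<epsilon> = f y' x \<epsilon>"
  shows "y = y'"
  using injective[OF section_in_pseudogroup[OF parameter_in_X[OF assms(1)], of \<epsilon>]] assms
  by (auto simp: inj_on_def)

lemma inverse_of_section: "(y, x, \<epsilon>) \<in> W \<Longrightarrow> g (f y x \<epsilon>) x \<epsilon> = y"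
  using inverse unfolding inverse_family_def by auto

lemma smooth_total_inverse: "smooth_on target total_inverse"
proof -
  have "target = {(f y x \<epsilon>, x, \<epsilon>) | y x \<epsilon>. (y, x, \<epsilon>) \<in> W}"
    using target_iff by auto
  then show ?thesis using inverse unfolding inverse_family_def total_inverse_def by simp
qed

text \<open>The map \<open>(y, x, \<epsilon>) \<mapsto> (f, x, \<epsilon>)\<close> is a continuous injection between spaces of equal
  dimension.\<close>

lemma open_target: "open target"
  unfolding target_def
proof (rule invariance_of_domain[OF _ open_W])
  show "continuous_on W (\<lambda>q. (total_map q, snd q))"
    by (intro continuous_intros smooth_on_continuous_on smooth_total_map)
  show "inj_on (\<lambda>q. (total_map q, snd q)) W"
    by (auto simp: inj_on_def total_map_def dest: section_injective)
qed

lemma differentiable_total_map: "q \<in> W \<Longrightarrow> total_map differentiable (at q)"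
  by (rule smooth_on_differentiable[OF smooth_total_map])

lemma differentiable_total_inverse: "q \<in> target \<Longrightarrow> total_inverse differentiable (at q)"
  by (rule smooth_on_differentiable[OF smooth_total_inverse])

lemma section_differentiable:
  assumes "(y, x, \<epsilon>) \<in> W"
  shows "(\<lambda>y. f y x \<epsilon>) differentiable (at y)"
proof -
  have "((\<lambda>y. (y, x, \<epsilon>)) has_derivative (\<lambda>h. (h, 0, 0))) (at y)"
    by (auto intro!: derivative_eq_intros simp: zero_prod_def)
  from has_derivative_compose[OF this has_derivative_directional[OF differentiable_total_map[OF assms]]]
  show ?thesis unfolding differentiable_def by (auto simp: total_map_def)
qed

lemma directional_deriv_section:
  assumes "(y, x, \<epsilon>) \<in> W"
  shows "directional_deriv h (\<lambda>y. f y x \<epsilon>) y = directional_deriv (h, 0, 0) total_map (y, x, \<epsilon>)"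
    and "directional_deriv k (\<lambda>x. f y x \<epsilon>) x = directional_deriv (0, k, 0) total_map (y, x, \<epsilon>)"
proof -
  have "((\<lambda>y. (y, x, \<epsilon>)) has_derivative (\<lambda>h. (h, 0, 0))) (at y)"
    "((\<lambda>x. (y, x, \<epsilon>)) has_derivative (\<lambda>h. (0, h, 0))) (at x)"
    by (auto intro!: derivative_eq_intros simp: zero_prod_def)
  from directional_deriv_compose[OF this(1) differentiable_total_map[OF assms], of h]
    directional_deriv_compose[OF this(2) differentiable_total_map[OF assms], of k]
  show "directional_deriv h (\<lambda>y. f y x \<epsilon>) y = directional_deriv (h, 0, 0) total_map (y, x, \<epsilon>)"
    and "directional_deriv k (\<lambda>x. f y x \<epsilon>) x = directional_deriv (0, k, 0) total_map (y, x, \<epsilon>)"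
    by (simp_all add: total_map_def)
qed

lemma jacobian_section:
  assumes "(y, x, \<epsilon>) \<in> W"
  shows "jacobian (\<lambda>y. f y x \<epsilon>) (at y) *v h = directional_deriv (h, 0, 0) total_map (y, x, \<epsilon>)"
  using jacobian_mult_eq_directional_deriv[OF section_differentiable[OF assms]]
    directional_deriv_section(1)[OF assms] by simp

text \<open>The chain rule for \<open>g (f y x \<epsilon>) x \<epsilon> = y\<close>. In particular \<open>\<partial>f/\<partial>y\<close> is injective, so that \<open>\<xi>\<close> is
  determined by \<open>\<delta>f = (\<partial>f/\<partial>y) \<xi>\<close>.\<close>

lemma directional_deriv_total_inverse:
  assumes q: "(y, x, \<epsilon>) \<in> W"
  shows "directional_deriv (directional_deriv (h, 0, 0) total_map (y, x, \<epsilon>), 0, 0)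
    total_inverse (f y x \<epsilon>, x, \<epsilon>) = h"
proof -
  have target: "(f y x \<epsilon>, x, \<epsilon>) \<in> target" using q by (auto simp: target_iff)
  have "((\<lambda>s. (y + s *\<^sub>R h, x, \<epsilon>)) has_vector_derivative (h, 0, 0)) (at 0)"
    by (auto intro!: has_vector_derivative_Pair derivative_eq_intros simp: zero_prod_def)
  from has_vector_derivative_along_curve[OF this, of total_map] differentiable_total_map q
  have "((\<lambda>s. f (y + s *\<^sub>R h) x \<epsilon>) has_vector_derivative
      directional_deriv (h, 0, 0) total_map (y, x, \<epsilon>)) (at 0)"
    by (simp add: total_map_def)
  then have "((\<lambda>s. (f (y + s *\<^sub>R h) x \<epsilon>, x, \<epsilon>)) has_vector_derivative
      (directional_deriv (h, 0, 0) total_map (y, x, \<epsilon>), 0, 0)) (at 0)"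
    by (intro has_vector_derivative_Pair has_vector_derivative_const)
  from has_vector_derivative_along_curve[OF this, of total_inverse] differentiable_total_inverse[OF target]
  have "((\<lambda>s. g (f (y + s *\<^sub>R h) x \<epsilon>) x \<epsilon>) has_vector_derivative
      directional_deriv (directional_deriv (h, 0, 0) total_map (y, x, \<epsilon>), 0, 0)
        total_inverse (f y x \<epsilon>, x, \<epsilon>)) (at 0)"
    by (simp add: total_inverse_def)
  moreover have "((\<lambda>s. g (f (y + s *\<^sub>R h) x \<epsilon>) x \<epsilon>) has_vector_derivative h) (at 0)"
  proof (rule has_vector_derivative_transform_within_open)
    show "((\<lambda>s. y + s *\<^sub>R h) has_vector_derivative h) (at 0)"
      by (auto intro!: derivative_eq_intros)
    show "open {s. (y + s *\<^sub>R h, x, \<epsilon>) \<in> W}"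
      using open_vimage[OF open_W, of "\<lambda>s. (y + s *\<^sub>R h, x, \<epsilon>)"]
      by (simp add: vimage_def continuous_intros)
  qed (use q inverse_of_section in auto)
  ultimately show ?thesis by (rule vector_derivative_unique_at)
qed

text \<open>Equivalently, the field \<open>(- \<xi>, 0, 1)\<close> on \<open>W\<close> is annihilated by the derivative of \<open>f\<close>.\<close>

lemma directional_deriv_total_map_parameter:
  assumes q: "(y, x, \<epsilon>) \<in> W"
  shows "directional_deriv (0, 0, 1) total_map (y, x, \<epsilon>) =
    directional_deriv (\<xi> y x \<epsilon>, 0, 0) total_map (y, x, \<epsilon>)"
proof -
  have "((\<lambda>t. (y, x, t)) has_vector_derivative (0, 0, 1)) (at \<epsilon>)"
    by (auto intro!: has_vector_derivative_Pair derivative_eq_intros)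
  from has_vector_derivative_along_curve[OF this, of total_map] differentiable_total_map q
  have "((\<lambda>t. f y x t) has_vector_derivative directional_deriv (0, 0, 1) total_map (y, x, \<epsilon>)) (at \<epsilon>)"
    by (simp add: total_map_def)
  from vector_derivative_unique_at[OF this variation[OF q]] jacobian_section[OF q]
  show ?thesis by simp
qed

definition comparison_domain :: "real \<Rightarrow> ((real ^ 'm) \<times> (real ^ 'n) \<times> real) set" where
  "comparison_domain \<epsilon> = {(y, x, t). (y, x, t) \<in> W \<and> (f y x t, x, \<epsilon>) \<in> target}"

text \<open>The map \<open>f\<^sub>\<epsilon>\<inverse> \<circ> f\<^sub>t\<close> at \<open>x\<close>, a deformation within \<open>\<Gamma>\<close> of the identity, which it equals at \<open>t = \<epsilon>\<close>.\<close>

definition comparison :: "real \<Rightarrow> (real ^ 'm) \<times> (real ^ 'n) \<times> real \<Rightarrow> real ^ 'm" where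
  "comparison \<epsilon> = (\<lambda>(y, x, t). g (f y x t) x \<epsilon>)"

lemma bounded_linear_fst_snd: "bounded_linear (\<lambda>q. fst (snd q))"
  by (rule bounded_linear_compose[OF bounded_linear_fst bounded_linear_snd])

lemma open_comparison_domain: "open (comparison_domain \<epsilon>)"
proof -
  have "continuous_on W (\<lambda>q. (total_map q, fst (snd q), \<epsilon>))"
    by (intro continuous_intros smooth_on_continuous_on smooth_total_map)
  from continuous_open_preimage[OF this open_W open_target]
  have "open (W \<inter> (\<lambda>q. (total_map q, fst (snd q), \<epsilon>)) -` target)" .
  also have "W \<inter> (\<lambda>q. (total_map q, fst (snd q), \<epsilon>)) -` target = comparison_domain \<epsilon>"
    by (auto simp: comparison_domain_def total_map_def)
  finally show ?thesis .
qed

lemma smooth_comparison: "smooth_on (comparison_domain \<epsilon>) (comparison \<epsilon>)"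
proof -
  have "smooth_on (comparison_domain \<epsilon>) (\<lambda>q. total_inverse (total_map q, fst (snd q), \<epsilon>))"
  proof (rule smooth_on_compose[OF smooth_total_inverse open_comparison_domain])
    show "smooth_on (comparison_domain \<epsilon>) (\<lambda>q. (total_map q, fst (snd q), \<epsilon>))"
      by (intro smooth_on_Pair open_comparison_domain smooth_on_const
          smooth_on_bounded_linear bounded_linear_fst_snd smooth_on_subset[OF smooth_total_map])
        (auto simp: comparison_domain_def)
  qed (auto simp: comparison_domain_def total_map_def)
  then show ?thesis
    by (simp add: total_inverse_def total_map_def comparison_def case_prod_unfold)
qed

lemma comparison_domain_diagonal: "(y, x, \<epsilon>) \<in> comparison_domain \<epsilon> \<longleftrightarrow> (y, x, \<epsilon>) \<in> W"
  by (auto simp: comparison_domain_def target_iff)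

text \<open>The velocity of \<open>f\<^sub>\<epsilon>\<inverse> \<circ> f\<^sub>t\<close> at \<open>t = \<epsilon>\<close> is \<open>(\<partial>f/\<partial>y)\<inverse> \<delta>f\<close>. This exhibits \<open>\<xi>\<close> as a derivative of a
  smooth function, whence its smoothness, and as tangent to a curve in \<open>\<Gamma>\<close>, whence the linearized
  equations.\<close>

lemma field_eq_derivative_of_comparison:
  assumes q: "(y, x, \<epsilon>) \<in> W"
  shows "\<xi> y x \<epsilon> = directional_deriv (0, 0, 1) (comparison \<epsilon>) (y, x, \<epsilon>)"
proof -
  have target: "(f y x \<epsilon>, x, \<epsilon>) \<in> target" using q by (auto simp: target_iff)
  have "((\<lambda>t. (y, x, t)) has_vector_derivative (0, 0, 1)) (at \<epsilon>)"
    by (auto intro!: has_vector_derivative_Pair derivative_eq_intros)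
  from has_vector_derivative_along_curve[OF this, of "comparison \<epsilon>"]
    smooth_on_differentiable[OF smooth_comparison] q comparison_domain_diagonal
  have "((\<lambda>t. comparison \<epsilon> (y, x, t)) has_vector_derivative
      directional_deriv (0, 0, 1) (comparison \<epsilon>) (y, x, \<epsilon>)) (at \<epsilon>)" by blast
  moreover have "((\<lambda>t. (f y x t, x, \<epsilon>)) has_vector_derivative
      (directional_deriv (\<xi> y x \<epsilon>, 0, 0) total_map (y, x, \<epsilon>), 0, 0)) (at \<epsilon>)"
    using variation[OF q] jacobian_section[OF q]
    by (intro has_vector_derivative_Pair has_vector_derivative_const) simp
  from has_vector_derivative_along_curve[OF this differentiable_total_inverse[OF target]]
  have "((\<lambda>t. comparison \<epsilon> (y, x, t)) has_vector_derivative \<xi> y x \<epsilon>) (at \<epsilon>)"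
    using directional_deriv_total_inverse[OF q, of "\<xi> y x \<epsilon>"]
    by (simp add: comparison_def total_inverse_def)
  ultimately show ?thesis by (rule vector_derivative_unique_at[symmetric])
qed

lemma open_slice: "open {(y, x). (y, x, \<epsilon>) \<in> W}"
  using open_vimage[OF open_W, of "\<lambda>(y, x). (y, x, \<epsilon>)"]
  by (simp add: vimage_def case_prod_unfold continuous_intros)

lemma smooth_field: "smooth_on {(y, x). (y, x, \<epsilon>) \<in> W} (\<lambda>(y, x). \<xi> y x \<epsilon>)"
proof (rule smooth_on_cong[OF open_slice])
  show "smooth_on {(y, x). (y, x, \<epsilon>) \<in> W}
      (\<lambda>p. directional_deriv (0, 0, 1) (comparison \<epsilon>) (fst p, snd p, \<epsilon>))"
  proof (rule smooth_on_compose[OF smooth_on_directional_deriv[OF smooth_comparison] open_slice])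
    show "smooth_on {(y, x). (y, x, \<epsilon>) \<in> W} (\<lambda>p. (fst p, snd p, \<epsilon>))"
      by (intro smooth_on_Pair open_slice smooth_on_const smooth_on_bounded_linear
          bounded_linear_fst bounded_linear_snd)
  qed (auto simp: comparison_domain_diagonal)
qed (auto simp: field_eq_derivative_of_comparison)

text \<open>Closure under inverses and compositions speaks of \<^const>\<open>inv_into\<close>, which agrees with \<open>g\<close> on the
  image of \<open>f\<^sub>\<epsilon>\<close> only; hence a map \<open>k\<close> that equals the comparison map on its own domain.\<close>

lemma comparison_in_pseudogroup:
  assumes inverse_closed: "\<And>S h. (S, h) \<in> \<Gamma> \<Longrightarrow> (h ` S, inv_into S h) \<in> \<Gamma>"
    and composition_closed: "\<And>S h T k. (S, h) \<in> \<Gamma> \<Longrightarrow> (T, k) \<in> \<Gamma> \<Longrightarrow> (S \<inter> h -` T, k \<circ> h) \<in> \<Gamma>"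
    and "(y, x, t) \<in> comparison_domain \<epsilon>"
  obtains D k where "(D, k) \<in> \<Gamma>" "y \<in> D" "\<And>y'. y' \<in> D \<Longrightarrow> k y' = comparison \<epsilon> (y', x, t)"
proof -
  let ?S = "\<lambda>t. {y. (y, x, t) \<in> W}" and ?f = "\<lambda>t y. f y x t"
  have x: "x \<in> X" using assms(3) parameter_in_X by (auto simp: comparison_domain_def)
  show thesis
  proof (rule that)
    show "(?S t \<inter> ?f t -` (?f \<epsilon> ` ?S \<epsilon>), inv_into (?S \<epsilon>) (?f \<epsilon>) \<circ> ?f t) \<in> \<Gamma>"
      by (intro composition_closed inverse_closed section_in_pseudogroup x)
    show "y \<in> ?S t \<inter> ?f t -` (?f \<epsilon> ` ?S \<epsilon>)"
      using assms(3) by (auto simp: comparison_domain_def target_iff)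
    fix y' assume "y' \<in> ?S t \<inter> ?f t -` (?f \<epsilon> ` ?S \<epsilon>)"
    then obtain y'' where "(y'', x, \<epsilon>) \<in> W" "f y' x t = f y'' x \<epsilon>" by auto
    then show "(inv_into (?S \<epsilon>) (?f \<epsilon>) \<circ> ?f t) y' = comparison \<epsilon> (y', x, t)"
      using inv_into_f_f[OF injective[OF section_in_pseudogroup[OF x, of \<epsilon>]], of y'']
      by (simp add: comparison_def inverse_of_section)
  qed
qed

text \<open>With \<open>z\<close> and \<open>x\<close> fixed, \<open>v\<close> is \<open>\<partial>f/\<partial>x\<close> along the curve \<open>\<epsilon> \<mapsto> (g z x \<epsilon>, x, \<epsilon>)\<close>, on which \<open>f\<close> is constant.
  Its velocity is therefore the annihilated field \<open>\<zeta> = (- \<xi>, 0, 1)\<close>, and the derivative sought is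
  \<open>- Df(\<partial>\<zeta>/\<partial>x) = (\<partial>f/\<partial>y) (\<partial>\<xi>/\<partial>x)\<close>.\<close>

lemma speed_has_vector_derivative:
  assumes q: "(y, x, \<epsilon>) \<in> W" and z: "z = f y x \<epsilon>"
  shows "((\<lambda>\<epsilon>'. generalized_speed (\<lambda>y x. f y x \<epsilon>') (\<lambda>z x. g z x \<epsilon>') z x $ k $ i)
    has_vector_derivative
      (jacobian (\<lambda>y'. f y' x \<epsilon>) (at y) ** jacobian (\<lambda>x'. \<xi> y x' \<epsilon>) (at x)) $ k $ i) (at \<epsilon>)"
proof -
  define u where "u = (0 :: real ^ 'm, axis i 1 :: real ^ 'n, 0 :: real)"
  define \<xi>' where "\<xi>' = directional_deriv (axis i 1) (\<lambda>x'. \<xi> y x' \<epsilon>) x"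
  define c where "c = (\<lambda>t. (g z x t, x, t))"
  define \<zeta> where "\<zeta> = (\<lambda>s. (- \<xi> y (x + s *\<^sub>R axis i 1) \<epsilon>, 0 :: real ^ 'n, 1 :: real))"
  have c0: "c \<epsilon> = (y, x, \<epsilon>)" using q z by (simp add: c_def inverse_of_section)
  have T: "open {t. (z, x, t) \<in> target}" "(z, x, \<epsilon>) \<in> target"
    using open_vimage[OF open_target, of "\<lambda>t. (z, x, t)"] q z
    by (auto simp: vimage_def continuous_intros target_iff)
  have cW: "c t \<in> W \<and> total_map (c t) = z" if "(z, x, t) \<in> target" for t
    using that by (auto simp: target_iff c_def inverse_of_section total_map_def)
  \<comment> \<open>\<open>\<eta>\<close> is the derivative of \<open>g\<close> in \<open>\<epsilon>\<close>. As \<open>f\<close> equals \<open>z\<close> along \<open>c\<close>, the injectivity of \<open>\<partial>f/\<partial>y\<close>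
    gives \<open>\<eta> = - \<xi>\<close>.\<close>
  define \<eta> where "\<eta> = directional_deriv (0, 0, 1) total_inverse (z, x, \<epsilon>)"
  have "((\<lambda>t. (z, x, t)) has_vector_derivative (0, 0, 1)) (at \<epsilon>)"
    by (auto intro!: has_vector_derivative_Pair derivative_eq_intros)
  from has_vector_derivative_along_curve[OF this differentiable_total_inverse[OF T(2)]]
  have "((\<lambda>t. g z x t) has_vector_derivative \<eta>) (at \<epsilon>)"
    by (simp add: total_inverse_def \<eta>_def)
  then have c': "(c has_vector_derivative (\<eta>, 0, 1)) (at \<epsilon>)"
    unfolding c_def by (intro has_vector_derivative_Pair has_vector_derivative_const)
      (auto intro!: derivative_eq_intros)
  have lin: "linear (\<lambda>v. directional_deriv v total_map (y, x, \<epsilon>))"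
    using has_derivative_linear[OF has_derivative_directional[OF differentiable_total_map[OF q]]] .
  have "((\<lambda>t. total_map (c t)) has_vector_derivative
      directional_deriv (\<eta>, 0, 1) total_map (y, x, \<epsilon>)) (at \<epsilon>)"
    using has_vector_derivative_along_curve[OF c', of total_map] differentiable_total_map[OF q] c0 by simp
  moreover have "((\<lambda>t. total_map (c t)) has_vector_derivative 0) (at \<epsilon>)"
    by (rule has_vector_derivative_transform_within_open[OF has_vector_derivative_const[of z] T(1)])
      (use T(2) cW in auto)
  ultimately have "directional_deriv (\<eta>, 0, 1) total_map (y, x, \<epsilon>) = 0"
    by (rule vector_derivative_unique_at)
  then have "directional_deriv (\<eta> + \<xi> y x \<epsilon>, 0, 0) total_map (y, x, \<epsilon>) = 0"
    using linear_add[OF lin, of "(\<eta>, 0, 0)" "(0, 0, 1)"] linear_add[OF lin, of "(\<eta>, 0, 0)" "(\<xi> y x \<epsilon>, 0, 0)"]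
      directional_deriv_total_map_parameter[OF q] by simp
  moreover have "directional_deriv (0, 0, 0) total_inverse (z, x, \<epsilon>) = 0"
    using linear_0[OF has_derivative_linear[OF has_derivative_directional[OF differentiable_total_inverse[OF T(2)]]]]
    by (simp add: zero_prod_def)
  ultimately have "\<eta> + \<xi> y x \<epsilon> = 0"
    using directional_deriv_total_inverse[OF q, of "\<eta> + \<xi> y x \<epsilon>"] z by simp
  then have "\<eta> = - \<xi> y x \<epsilon>" by (simp add: eq_neg_iff_add_eq_0)
  then have c\<zeta>: "(c has_vector_derivative \<zeta> 0) (at \<epsilon>)" using c' by (simp add: \<zeta>_def)
  have "(\<lambda>x'. \<xi> y x' \<epsilon>) differentiable (at x)"
  proof -
    have "((\<lambda>x'. (y, x')) has_derivative (\<lambda>h. (0, h))) (at x)"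
      by (auto intro!: derivative_eq_intros)
    from has_derivative_compose[OF this has_derivative_directional[OF smooth_on_differentiable[OF smooth_field]]] q
    show ?thesis unfolding differentiable_def by auto
  qed
  note \<xi>_diff = this
  have "((\<lambda>s. x + s *\<^sub>R axis i 1) has_vector_derivative axis i 1) (at 0)"
    by (auto intro!: derivative_eq_intros)
  from has_vector_derivative_along_curve[OF this, of "\<lambda>x'. \<xi> y x' \<epsilon>"] \<xi>_diff
  have "((\<lambda>s. \<xi> y (x + s *\<^sub>R axis i 1) \<epsilon>) has_vector_derivative \<xi>') (at 0)"
    by (simp add: \<xi>'_def)
  then have \<zeta>': "(\<zeta> has_vector_derivative (- \<xi>', 0, 0)) (at 0)"
    unfolding \<zeta>_def by (intro has_vector_derivative_Pair has_vector_derivative_const has_vector_derivative_minus)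
  have annihilated: "directional_deriv (\<zeta> s) total_map ((y, x, \<epsilon>) + s *\<^sub>R u) = 0"
    if "(y, x, \<epsilon>) + s *\<^sub>R u \<in> W" for s
  proof -
    let ?x = "x + s *\<^sub>R axis i 1"
    have q': "(y, ?x, \<epsilon>) \<in> W" using that by (simp add: u_def)
    have lin: "linear (\<lambda>v. directional_deriv v total_map (y, ?x, \<epsilon>))"
      using has_derivative_linear[OF has_derivative_directional[OF differentiable_total_map[OF q']]] .
    show ?thesis
      using linear_diff[OF lin, of "(0, 0, 1)" "(\<xi> y ?x \<epsilon>, 0, 0)"]
        directional_deriv_total_map_parameter[OF q'] by (simp add: \<zeta>_def u_def)
  qed
  have "((\<lambda>t. directional_deriv u total_map (c t)) has_vector_derivative
      - directional_deriv (- \<xi>', 0, 0) total_map (y, x, \<epsilon>)) (at \<epsilon>)"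
    by (rule derivative_of_partial_along_annihilated_velocity[OF open_W smooth_total_map q \<zeta>' annihilated c\<zeta> c0])
  also have "- directional_deriv (- \<xi>', 0, 0) total_map (y, x, \<epsilon>) =
      jacobian (\<lambda>y'. f y' x \<epsilon>) (at y) *v \<xi>'"
    using linear_neg[OF lin, of "(\<xi>', 0, 0)"] jacobian_section[OF q] by simp
  finally have "((\<lambda>t. directional_deriv u total_map (c t) $ k) has_vector_derivative
      (jacobian (\<lambda>y'. f y' x \<epsilon>) (at y) *v \<xi>') $ k) (at \<epsilon>)"
    by (rule bounded_linear.has_vector_derivative[OF bounded_linear_vec_nth])
  also have "(jacobian (\<lambda>y'. f y' x \<epsilon>) (at y) *v \<xi>') $ k =
      (jacobian (\<lambda>y'. f y' x \<epsilon>) (at y) ** jacobian (\<lambda>x'. \<xi> y x' \<epsilon>) (at x)) $ k $ i"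
    by (simp add: matrix_vector_mult_def matrix_matrix_mult_def jacobian_nth_eq_directional_deriv[of "\<lambda>x'. \<xi> y x' \<epsilon>"] \<xi>'_def)
  finally show ?thesis
  proof (rule has_vector_derivative_transform_within_open[OF _ T(1)])
    fix t assume "t \<in> {t. (z, x, t) \<in> target}"
    then have "(g z x t, x, t) \<in> W" using cW[of t] by (simp add: c_def)
    then show "directional_deriv u total_map (c t) $ k =
        generalized_speed (\<lambda>y x. f y x t) (\<lambda>z x. g z x t) z x $ k $ i"
      by (simp add: generalized_speed_def jacobian_nth_eq_directional_deriv
          directional_deriv_section(2) c_def u_def)
  qed (use T(2) in simp)
qed

end

section \<open>The variation of the generalized speed\<close>

theorem theorem3:
  fixes Y :: "(real ^ 'm) set" and X :: "(real ^ 'n) set"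
    and q :: nat and idx :: "'j::finite \<Rightarrow> 'm multiset"
    and \<Phi> :: "('m, 'j) jet \<Rightarrow> 'e::euclidean_space"
    and \<Gamma> \<Theta> :: "'m local_map set"
    and W :: "((real ^ 'm) \<times> (real ^ 'n) \<times> real) set"
    and f g \<xi> :: "real ^ 'm \<Rightarrow> real ^ 'n \<Rightarrow> real \<Rightarrow> real ^ 'm"
    and v :: "real ^ 'm \<Rightarrow> real ^ 'n \<Rightarrow> real \<Rightarrow> real ^ 'n ^ 'm"
  assumes pseudogroup: "lie_pseudogroup Y q idx \<Phi> \<Gamma>"
    and infinitesimal: "\<Theta> = infinitesimal_solutions Y idx \<Phi>"
    and X: "open X"
    and family: "section_family \<Gamma> X W f"
    and inverse: "inverse_family W f g"
    and speed: "\<And>z x \<epsilon>. v z x \<epsilon> = generalized_speed (\<lambda>y x. f y x \<epsilon>) (\<lambda>z x. g z x \<epsilon>) z x"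
    and variation: "\<And>y x \<epsilon>. (y, x, \<epsilon>) \<in> W \<Longrightarrow>
      ((\<lambda>\<epsilon>'. f y x \<epsilon>') has_vector_derivative
        jacobian (\<lambda>y'. f y' x \<epsilon>) (at y) *v \<xi> y x \<epsilon>) (at \<epsilon>)"
  shows "(\<forall>\<epsilon>. vertical_field \<Theta> X {(y, x). (y, x, \<epsilon>) \<in> W} (\<lambda>y x. \<xi> y x \<epsilon>)) \<and>
    (\<forall>y x \<epsilon> z. (y, x, \<epsilon>) \<in> W \<longrightarrow> z = f y x \<epsilon> \<longrightarrow>
      ((\<lambda>\<epsilon>'. v z x \<epsilon>') has_vector_derivative
        jacobian (\<lambda>y'. f y' x \<epsilon>) (at (g z x \<epsilon>)) **
        jacobian (\<lambda>x'. \<xi> (g z x \<epsilon>) x' \<epsilon>) (at x)) (at \<epsilon>) \<and>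
      (\<forall>k i. ((\<lambda>\<epsilon>'. v z x \<epsilon>' $ k $ i) has_real_derivative
        (\<Sum>l\<in>UNIV. jacobian (\<lambda>y'. f y' x \<epsilon>) (at (g z x \<epsilon>)) $ k $ l *
          jacobian (\<lambda>x'. \<xi> (g z x \<epsilon>) x' \<epsilon>) (at x) $ l $ i)) (at \<epsilon>)))"
proof -
  have \<Gamma>_aut: "\<And>S h. (S, h) \<in> \<Gamma> \<Longrightarrow> (S, h) \<in> aut Y"
    and \<Gamma>_equation: "\<And>S h y. (S, h) \<in> \<Gamma> \<Longrightarrow> y \<in> S \<Longrightarrow> \<Phi> (jet idx h y) = 0"
    and identity: "(Y, \<lambda>y. y) \<in> \<Gamma>"
    and composition: "\<And>S h T k. (S, h) \<in> \<Gamma> \<Longrightarrow> (T, k) \<in> \<Gamma> \<Longrightarrow> (S \<inter> h -` T, k \<circ> h) \<in> \<Gamma>"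
    and inverses: "\<And>S h. (S, h) \<in> \<Gamma> \<Longrightarrow> (h ` S, inv_into S h) \<in> \<Gamma>"
    and \<Phi>_smooth: "smooth_on (invertible_jets idx Y) \<Phi>"
    using pseudogroup by (auto simp: lie_pseudogroup_def finite_solutions_def)
  have \<Gamma>D: "open S" "S \<subseteq> Y" "inj_on h S" if "(S, h) \<in> \<Gamma>" for S h
    using \<Gamma>_aut[OF that] by (auto simp: aut_def)
  interpret variation_of_section \<Gamma> X W f g \<xi>
    by unfold_locales (use \<Gamma>D family inverse variation in auto)
  have "vertical_field \<Theta> X {(y, x). (y, x, \<epsilon>) \<in> W} (\<lambda>y x. \<xi> y x \<epsilon>)" for \<epsilon>
    unfolding vertical_field_def
  proof (intro conjI ballI)
    show "smooth_on {(y, x). (y, x, \<epsilon>) \<in> W} (\<lambda>(y, x). \<xi> y x \<epsilon>)" by (rule smooth_field)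
    fix x assume x: "x \<in> X"
    define S where "S = {y. (y, x, \<epsilon>) \<in> W}"
    define U where "U = {(y, t). (y, x, t) \<in> comparison_domain \<epsilon>}"
    define H where "H = (\<lambda>(y, t). comparison \<epsilon> (y, x, t))"
    have S: "open S" "S \<subseteq> Y"
      using \<Gamma>D section_in_pseudogroup[OF x, of \<epsilon>] by (auto simp: S_def)
    have U: "open U"
      using open_vimage[OF open_comparison_domain[of \<epsilon>], of "\<lambda>(y, t). (y, x, t)"]
      by (simp add: U_def vimage_def case_prod_unfold continuous_intros)
    have "smooth_on U (\<lambda>p. comparison \<epsilon> (fst p, x, snd p))"
    proof (rule smooth_on_compose[OF smooth_comparison U])
      show "smooth_on U (\<lambda>p. (fst p, x, snd p))"
        by (intro smooth_on_Pair U smooth_on_const smooth_on_bounded_linear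
            bounded_linear_fst bounded_linear_snd)
    qed (auto simp: U_def)
    then have H: "smooth_on U H" by (simp add: H_def case_prod_unfold)
    have "smooth_on S (\<lambda>y. (\<lambda>(y, x). \<xi> y x \<epsilon>) (y, x))"
    proof (rule smooth_on_compose[OF smooth_field[of \<epsilon>] S(1)])
      show "smooth_on S (\<lambda>y. (y, x))"
        by (intro smooth_on_Pair S smooth_on_const smooth_on_bounded_linear bounded_linear_ident)
    qed (auto simp: S_def)
    moreover have "frechet_derivative \<Phi> (at (jet idx (\<lambda>y. y) y)) (0, derivs idx (\<lambda>y. \<xi> y x \<epsilon>) y) = 0"
      if y: "y \<in> S" for y
    proof -
      have p: "(y', \<epsilon>) \<in> U \<longleftrightarrow> y' \<in> S" for y'
        by (simp add: U_def S_def comparison_domain_diagonal)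
      have "jet idx (\<lambda>y. y) y \<in> invertible_jets idx Y"
        using \<Gamma>_aut[OF identity] y S by (auto simp: invertible_jets_def)
      then have \<Phi>: "\<Phi> differentiable (at (jet idx (\<lambda>y. y) y))"
        by (rule smooth_on_differentiable[OF \<Phi>_smooth])
      have equation: "\<Phi> (jet idx (\<lambda>y. H (y, t)) y) = 0" if t: "(y, t) \<in> U" for t
      proof -
        obtain D k where k: "(D, k) \<in> \<Gamma>" "y \<in> D" "\<And>y'. y' \<in> D \<Longrightarrow> k y' = comparison \<epsilon> (y', x, t)"
          by (rule comparison_in_pseudogroup[OF inverses composition, of y x t \<epsilon>])
            (use t in \<open>auto simp: U_def\<close>)
        have "derivs idx k y = derivs idx (\<lambda>y. H (y, t)) y"
          by (rule derivs_cong[OF \<Gamma>D(1)[OF k(1)] _ k(2)]) (simp add: k(3) H_def)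
        then show ?thesis using \<Gamma>_equation[OF k(1,2)] by (simp add: jet_def)
      qed
      have "H (y', \<epsilon>) = y'" if "(y', \<epsilon>) \<in> U" for y'
        using that by (auto simp: p S_def H_def comparison_def inverse_of_section)
      from linearized_equation_of_deformation_of_identity[OF U H _ \<Phi> equation this] y
      have "frechet_derivative \<Phi> (at (jet idx (\<lambda>y. y) y))
          (0, derivs idx (\<lambda>y. directional_deriv (0, 1) H (y, \<epsilon>)) y) = 0" by (simp add: p)
      moreover have "directional_deriv (0, 1) H (y', \<epsilon>) = \<xi> y' x \<epsilon>" if "y' \<in> S" for y'
      proof -
        have W: "(y', x, \<epsilon>) \<in> W" using that by (simp add: S_def)
        have "((\<lambda>p. (fst p, x, snd p)) has_derivative (\<lambda>h. (fst h, 0, snd h))) (at (y', \<epsilon>))"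
          by (auto intro!: derivative_eq_intros)
        from directional_deriv_compose[OF this, of "comparison \<epsilon>" "(0, 1)"]
          smooth_on_differentiable[OF smooth_comparison] W
        show ?thesis
          by (simp add: H_def case_prod_unfold field_eq_derivative_of_comparison[OF W] comparison_domain_diagonal)
      qed
      then have "derivs idx (\<lambda>y. directional_deriv (0, 1) H (y, \<epsilon>)) y = derivs idx (\<lambda>y. \<xi> y x \<epsilon>) y"
        by (rule derivs_cong[OF S(1) _ y])
      ultimately show ?thesis by simp
    qed
    ultimately have "(S, \<lambda>y. \<xi> y x \<epsilon>) \<in> infinitesimal_solutions Y idx \<Phi>"
      using S by (simp add: infinitesimal_solutions_def)
    then show "({y. (y, x) \<in> {(y, x). (y, x, \<epsilon>) \<in> W}}, \<lambda>y. \<xi> y x \<epsilon>) \<in> \<Theta>"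
      by (simp add: infinitesimal S_def)
  qed
  moreover have "((\<lambda>\<epsilon>'. v z x \<epsilon>' $ k $ i) has_vector_derivative
      (jacobian (\<lambda>y'. f y' x \<epsilon>) (at (g z x \<epsilon>)) **
        jacobian (\<lambda>x'. \<xi> (g z x \<epsilon>) x' \<epsilon>) (at x)) $ k $ i) (at \<epsilon>)"
    if "(y, x, \<epsilon>) \<in> W" "z = f y x \<epsilon>" for y x \<epsilon> z k i
    using speed_has_vector_derivative[OF that] that by (simp add: speed inverse_of_section)
  ultimately show ?thesis
    by (auto intro!: has_vector_derivative_vec
        simp: has_real_derivative_iff_has_vector_derivative matrix_matrix_mult_def)
qed

end
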